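(* Let $\mathcal{L}$ denote the equation $p_1x_1+\dots+p_kx_k=rz$ where $p_1,\dots,p_k,r\in\mathbb{N}$ satisfy $\gcd(p_1,\dots,p_k,r)=1$ and $p_1\geq\dots\geq p_k\geq r$. Suppose that $p:=\sum_{i=1}^{k-1}p_i$ and $q:=p_k$ satisfy $t:=\gcd(p,q)=\gcd(p_1,\dots,p_k)$. Then, as $n\to\infty$, $$f_{\max}(n,\mathcal{L})\leq 2^{\frac{Crn}{q}+o(n)},\qquad\text{where } C:=1-\frac{t}{p+q}\Big(\frac{p^2+(p-t)(q-t)}{p^2}\Big).$$
   Context: $[n]=\{1,\dots,n\}$. A set $A\subseteq[n]$ is $\mathcal{L}$-free if there is no solution $(x_1,\dots,x_k,z)$ to $\mathcal{L}$ with all entries in $A$ (entries need not be distinct; since the coefficient sum $\sum p_i-r$ is nonzero, all solutions count as non-trivial). $f_{\max}(n,\mathcal{L})$ denotes the number of maximal (with respect to inclusion) $\mathcal{L}$-free subsets of $[n]$. *)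

theory Defs
  imports Complex_Main "HOL-Library.Landau_Symbols"
begin

text \<open>
  The equation \<open>p 1 * x 1 + \<dots> + p k * x k = r * z\<close> is given by its number of variables \<open>k\<close>,
  the coefficient function \<open>p\<close> (only its values on \<open>{1..k}\<close> matter) and \<open>r\<close>.
\<close>

definition is_solution ::
  "nat \<Rightarrow> (nat \<Rightarrow> nat) \<Rightarrow> nat \<Rightarrow> (nat \<Rightarrow> nat) \<Rightarrow> nat \<Rightarrow> bool" where
  "is_solution k p r x z \<longleftrightarrow> (\<Sum>i=1..k. p i * x i) = r * z"

definition solution_free :: "nat \<Rightarrow> (nat \<Rightarrow> nat) \<Rightarrow> nat \<Rightarrow> nat set \<Rightarrow> bool" where
  "solution_free k p r A \<longleftrightarrow>
     \<not> (\<exists>x z. (\<forall>i\<in>{1..k}. x i \<in> A) \<and> z \<in> A \<and> is_solution k p r x z)"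

definition maximal_solution_free ::
  "nat \<Rightarrow> nat \<Rightarrow> (nat \<Rightarrow> nat) \<Rightarrow> nat \<Rightarrow> nat set \<Rightarrow> bool" where
  "maximal_solution_free n k p r A \<longleftrightarrow>
     A \<subseteq> {1..n} \<and> solution_free k p r A \<and>
     (\<forall>B. A \<subset> B \<and> B \<subseteq> {1..n} \<longrightarrow> \<not> solution_free k p r B)"

definition f_max :: "nat \<Rightarrow> nat \<Rightarrow> (nat \<Rightarrow> nat) \<Rightarrow> nat \<Rightarrow> nat" where
  "f_max n k p r = card {A. maximal_solution_free n k p r A}"

end

theory Submission
  imports Defs "HOL-Real_Asymp.Real_Asymp" "HOL-Number_Theory.Cong"
begin

text \<open>
  Setting \<open>x 1 = \<dots> = x (k - 1)\<close> shows that a solution-free set has no solution of \<open>P * x + q * y = r * z\<close>.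
  For a maximal solution-free \<open>M\<close>, only multiples of \<open>t\<close> can be \<open>z\<close> in a solution. Let \<open>S\<close> be
  the \<open>K\<close> largest multiples of \<open>t\<close> in \<open>M\<close> and \<open>b\<close> the least of them; there are only polynomially many
  choices for \<open>(S, b)\<close>. Given \<open>S\<close> and \<open>b\<close>, \<open>M\<close> is determined by its part below
  \<open>max (r * b / q) (r * n / (2 * q))\<close>. If the second bound is the larger one, there are at most
  \<open>2 powr (r * n / (2 * q))\<close> choices, and \<open>C \<ge> 1 / 2\<close>. Otherwise the part of \<open>M\<close> below \<open>r * b / q\<close> is an
  independent set of the graph joining \<open>x\<close> and \<open>y\<close> if \<open>P * x + q * y = r * s\<close> for some \<open>s \<in> S\<close>. After
  branching on vertices of large degree this graph has bounded degree, so for \<open>K\<close> large some \<open>s \<in> S\<close>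
  contributes few edges, and a matching formed by the solutions for this \<open>s\<close> shows that at most
  \<open>C * r * n / q + o(n)\<close> vertices are left.
\<close>

subsection \<open>Counting independent sets\<close>

definition nbrs :: "('a \<Rightarrow> 'a \<Rightarrow> bool) \<Rightarrow> 'a set \<Rightarrow> 'a \<Rightarrow> 'a set" where
  "nbrs E V v = {y \<in> V. E v y}"

definition indep_sets :: "('a \<Rightarrow> 'a \<Rightarrow> bool) \<Rightarrow> 'a set \<Rightarrow> 'a set set" where
  "indep_sets E V = {I. I \<subseteq> V \<and> (\<forall>x\<in>I. \<forall>y\<in>I. \<not> E x y)}"

lemma finite_indep_sets: "finite V \<Longrightarrow> finite (indep_sets E V)"
  unfolding indep_sets_def by simp

text \<open>An independent set either avoids \<open>v\<close>, or contains \<open>v\<close> and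
  hence no neighbour of \<open>v\<close>; in the second case it is recovered from its remaining
  elements.\<close>

lemma card_indep_sets_branch:
  assumes "finite V" "v \<in> V"
  shows "card (indep_sets E V) \<le>
    card (indep_sets E (V - {v})) + card (indep_sets E (V - insert v (nbrs E V v)))"
proof -
  have sub: "indep_sets E V \<subseteq> indep_sets E (V - {v}) \<union>
      insert v ` indep_sets E (V - insert v (nbrs E V v))" (is "_ \<subseteq> _ \<union> insert v ` ?B")
  proof
    fix I assume I: "I \<in> indep_sets E V"
    show "I \<in> indep_sets E (V - {v}) \<union> insert v ` ?B"
    proof (cases "v \<in> I")
      case True
      then have "I - {v} \<in> ?B" "I = insert v (I - {v})"
        using I unfolding indep_sets_def nbrs_def by auto
      then show ?thesis by blast
    next
      case False
      then show ?thesis using I unfolding indep_sets_def by auto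
    qed
  qed
  have fin: "finite ?B" "finite (indep_sets E (V - {v}))"
    using assms by (auto intro: finite_indep_sets)
  have "card (indep_sets E V) \<le> card (indep_sets E (V - {v}) \<union> insert v ` ?B)"
    using sub fin by (intro card_mono) auto
  also have "\<dots> \<le> card (indep_sets E (V - {v})) + card (insert v ` ?B)"
    by (rule card_Un_le)
  also have "\<dots> \<le> card (indep_sets E (V - {v})) + card ?B"
    using card_image_le[OF fin(1)] by simp
  finally show ?thesis .
qed

text \<open>Branching on a vertex of degree at least \<open>d\<close> costs a factor \<open>l\<close> per deleted vertex.\<close>

lemma card_indep_sets_le:
  fixes l m :: real
  assumes "finite V" and l: "l \<ge> 1" "l ^ d \<ge> l ^ (d - 1) + 1"
    and "\<And>W. W \<subseteq> V \<Longrightarrow> (\<And>v. v \<in> W \<Longrightarrow> card (nbrs E W v) < d) \<Longrightarrow> real (card W) \<le> m"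
  shows "real (card (indep_sets E V)) \<le> l ^ card V * 2 powr m"
  using assms(1,4)
proof (induction "card V" arbitrary: V rule: less_induct)
  case less
  \<comment> \<open>For \<open>d = 0\<close> the truncated \<open>d - 1\<close> would turn the
    hypothesis on \<open>l\<close> into \<open>1 \<ge> 2\<close>.\<close>
  have d: "d \<ge> 1" using l by (cases d) auto
  show ?case
  proof (cases "\<exists>v\<in>V. card (nbrs E V v) \<ge> d")
    case False
    then have m: "real (card V) \<le> m"
      using less.prems(2)[of V] by (auto simp: not_le)
    have "card (indep_sets E V) \<le> card (Pow V)"
      using less.prems(1) by (intro card_mono) (auto simp: indep_sets_def)
    also have "\<dots> = 2 ^ card V" using less.prems(1) by (rule card_Pow)
    finally have "real (card (indep_sets E V)) \<le> 2 powr real (card V)"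
      by (simp add: powr_realpow)
    also have "\<dots> \<le> 2 powr m" using m by simp
    also have "\<dots> \<le> l ^ card V * 2 powr m" using l by simp
    finally show ?thesis .
  next
    case True
    then obtain v where v: "v \<in> V" "card (nbrs E V v) \<ge> d" by blast
    let ?V1 = "V - {v}" and ?V2 = "V - insert v (nbrs E V v)"
    have fN: "finite (nbrs E V v)" using less.prems(1) by (simp add: nbrs_def)
    have c1: "card ?V1 = card V - 1" using v less.prems(1) by simp
    have pos: "card V > 0" using v less.prems(1) card_gt_0_iff by blast
    have "card ?V2 \<le> card (V - nbrs E V v)"
      using less.prems(1) by (intro card_mono) auto
    also have "\<dots> = card V - card (nbrs E V v)"
      using fN by (intro card_Diff_subset) (auto simp: nbrs_def)
    also have "\<dots> \<le> card V - d" using v by simp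
    finally have c2: "card ?V2 \<le> card V - d" .
    have dV: "d \<le> card V"
      using v(2) card_mono[OF less.prems(1), of "nbrs E V v"] by (auto simp: nbrs_def)
    have hyp: "\<And>U. U \<subset> V \<Longrightarrow> real (card (indep_sets E U)) \<le> l ^ card U * 2 powr m"
      using less.prems by (intro less.hyps psubset_card_mono) (auto dest: finite_subset)
    have "real (card (indep_sets E V)) \<le>
        real (card (indep_sets E ?V1)) + real (card (indep_sets E ?V2))"
      using card_indep_sets_branch[OF less.prems(1) v(1), of E] by linarith
    also have "\<dots> \<le> l ^ card ?V1 * 2 powr m + l ^ card ?V2 * 2 powr m"
      using v by (intro add_mono hyp) auto
    also have "\<dots> \<le> l ^ (card V - 1) * 2 powr m + l ^ (card V - d) * 2 powr m"
      using c1 c2 l by (intro add_mono mult_right_mono power_increasing) auto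
    also have "\<dots> = l ^ (card V - d) * (l ^ (d - 1) + 1) * 2 powr m"
      using d dV by (simp add: algebra_simps flip: power_add)
    also have "\<dots> \<le> l ^ (card V - d) * l ^ d * 2 powr m"
      using l by (intro mult_right_mono mult_left_mono) auto
    also have "\<dots> = l ^ card V * 2 powr m"
      using dV by (simp flip: power_add)
    finally show ?thesis .
  qed
qed

text \<open>The difference \<open>l ^ d - l ^ (d - 1) = l ^ (d - 1) * (l - 1)\<close> is unbounded
  in \<open>d\<close>. So the cost \<open>l\<close> per vertex may be taken as close to 1 as
  desired.\<close>

lemma exists_branching_degree:
  fixes l :: real
  assumes "l > 1"
  obtains d where "l ^ d \<ge> l ^ (d - 1) + 1"
proof -
  obtain n where "1 / (l - 1) < l ^ n" using real_arch_pow[OF assms] by blast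
  then have "l ^ Suc n \<ge> l ^ n + 1" using assms by (simp add: field_simps)
  then show ?thesis using that[of "Suc n"] by simp
qed

section \<open>Choices of the largest elements\<close>

text \<open>A list of the elements is padded to length \<open>K\<close> with \<open>0\<close>, which
  lies outside \<open>{1..n}\<close>; dropping \<open>0\<close> recovers the set.\<close>

lemma card_bounded_subsets_le:
  "card {S. S \<subseteq> {1..n::nat} \<and> card S \<le> K} \<le> (n + 1) ^ K"
proof -
  let ?L = "{xs. set xs \<subseteq> {0..n} \<and> length xs = K}"
  have fin: "finite ?L" by (rule finite_lists_length_eq) simp
  have "{S. S \<subseteq> {1..n} \<and> card S \<le> K} \<subseteq> (\<lambda>xs. set xs - {0}) ` ?L"
  proof clarify
    fix S assume S: "S \<subseteq> {1..n}" "card S \<le> K"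
    then have "finite S" using finite_subset by blast
    then obtain ys where ys: "set ys = S" "length ys = card S"
      using finite_distinct_list distinct_card by metis
    let ?xs = "ys @ replicate (K - card S) 0"
    have "?xs \<in> ?L" "S = set ?xs - {0}" using S ys by auto
    then show "S \<in> (\<lambda>xs. set xs - {0}) ` ?L" by blast
  qed
  then have "card {S. S \<subseteq> {1..n} \<and> card S \<le> K} \<le> card ((\<lambda>xs. set xs - {0}) ` ?L)"
    using fin by (intro card_mono) auto
  also have "\<dots> \<le> card ?L" using fin by (rule card_image_le)
  also have "\<dots> = (n + 1) ^ K" by (simp add: card_lists_length_eq)
  finally show ?thesis .
qed

text \<open>The \<open>K\<close> largest elements of \<open>T\<close>; the threshold is \<open>b = 0\<close> when there are fewer.\<close>

lemma exists_top_subset: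
  fixes T :: "nat set"
  assumes "finite T"
  shows "\<exists>S b. S \<subseteq> T \<and> card S \<le> K \<and> (\<forall>z\<in>T - S. z \<le> b) \<and> (\<forall>s\<in>S. b \<le> s) \<and>
    (b = 0 \<or> card S = K)"
proof (induction K)
  case 0
  show ?case
    using assms by (intro exI[of _ "{}"] exI[of _ "Max (insert 0 T)"]) auto
next
  case (Suc K)
  then obtain S b where S: "S \<subseteq> T" "card S \<le> K" "\<forall>z\<in>T - S. z \<le> b" "\<forall>s\<in>S. b \<le> s"
    "b = 0 \<or> card S = K" by blast
  have fin: "finite S" using S(1) assms finite_subset by blast
  show ?case
  proof (cases "card S < K \<or> T - S = {}")
    case True
    \<comment> \<open>If \<open>card S < K\<close>, then \<open>b\<close> is already 0; if
      \<open>T - S\<close> is empty, every threshold works, and 0 is the one allowed for a set with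
      fewer than \<open>Suc K\<close> elements.\<close>
    then show ?thesis using S by (intro exI[of _ S] exI[of _ 0]) auto
  next
    case False
    then have "card S = K" using S(2) by simp
    moreover have "Max (T - S) \<in> T - S" using False assms by (intro Max_in) auto
    moreover have "\<forall>z\<in>T - S. z \<le> Max (T - S)" using assms by auto
    moreover have "\<forall>s\<in>S. Max (T - S) \<le> s"
      using calculation(2) S(3,4) order_trans by blast
    ultimately have "insert (Max (T - S)) S \<subseteq> T" "card (insert (Max (T - S)) S) = Suc K"
      "\<forall>z\<in>T - insert (Max (T - S)) S. z \<le> Max (T - S)"
      "\<forall>s\<in>insert (Max (T - S)) S. Max (T - S) \<le> s"
      using S(1) fin by auto
    then show ?thesis by (metis order_refl)
  qed
qed

subsection \<open>A matching in the graph of solutions\<close>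

lemma real_div_bounds:
  "real (x div y) \<le> real x / real y" "real x / real y - 1 \<le> real (x div y)"
proof -
  have x: "real x = real y * real (x div y) + real (x mod y)"
    by (metis of_nat_add of_nat_mult mult_div_mod_eq)
  show "real (x div y) \<le> real x / real y"
  proof (cases "y = 0")
    case False
    have "real (x div y) * real y \<le> real x" using x by simp
    then show ?thesis using False by (simp add: pos_le_divide_eq)
  qed simp
  show "real x / real y - 1 \<le> real (x div y)"
  proof (cases "y = 0")
    case False
    then have "real x \<le> (real (x div y) + 1) * real y"
      using x by (simp add: algebra_simps less_imp_le)
    then have "real x / real y \<le> real (x div y) + 1" using False by (simp add: pos_divide_le_eq)
    then show ?thesis by simp
  qed simp
qed

section \<open>Residue classes and periodic conditions\<close>

lemma card_mod_eq:
  fixes a c r :: nat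
  assumes "r < a"
  shows "card {v. v < a * c \<and> v mod a = r} = c"
proof -
  have "{v. v < a * c \<and> v mod a = r} = (\<lambda>j. a * j + r) ` {..<c}"
  proof (intro equalityI subsetI)
    fix v assume "v \<in> {v. v < a * c \<and> v mod a = r}"
    then have "v = a * (v div a) + r" "v div a < c"
      by (auto simp: less_mult_imp_div_less mult.commute)
    then show "v \<in> (\<lambda>j. a * j + r) ` {..<c}" by blast
  next
    fix v assume "v \<in> (\<lambda>j. a * j + r) ` {..<c}"
    then obtain j where j: "j < c" "v = a * j + r" by auto
    have "a * j + r < a * Suc j" using assms by simp
    also have "\<dots> \<le> a * c" using j by (intro mult_le_mono2) simp
    finally show "v \<in> {v. v < a * c \<and> v mod a = r}" using j assms by simp
  qed
  moreover have "inj_on (\<lambda>j. a * j + r) {..<c}" using assms by (auto intro: inj_onI)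
  ultimately show ?thesis by (simp add: card_image)
qed

text \<open>By the Chinese remainder theorem every pair of residues is attained by some
  \<open>u < m * n\<close>.\<close>

lemma card_pairs_le_card_residues:
  fixes m n :: nat
  assumes "coprime m n" "m > 0" "n > 0" "R \<subseteq> {..<m} \<times> {..<n}"
  shows "card R \<le> card {u. u < m * n \<and> (u mod m, u mod n) \<in> R}"
proof -
  have "R \<subseteq> (\<lambda>u. (u mod m, u mod n)) ` {u. u < m * n \<and> (u mod m, u mod n) \<in> R}"
  proof clarify
    fix i j assume ij: "(i, j) \<in> R"
    then have "i < m" "j < n" using assms by auto
    moreover obtain u where "u < m * n" "[u = i] (mod m)" "[u = j] (mod n)"
      using binary_chinese_remainder_unique_nat[OF assms(1), of i j] assms by auto
    ultimately have "u < m * n" "u mod m = i" "u mod n = j" by (auto simp: cong_def)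
    then show "(i, j) \<in> (\<lambda>u. (u mod m, u mod n)) ` {u. u < m * n \<and> (u mod m, u mod n) \<in> R}"
      using ij by (intro image_eqI[of _ _ u]) auto
  qed
  then show ?thesis by (intro surj_card_le[rotated]) auto
qed

text \<open>The numbers below \<open>N\<close> contain \<open>N div c\<close> disjoint complete
  periods.\<close>

lemma card_periodic_ge:
  fixes g :: "nat \<Rightarrow> bool"
  assumes per: "\<And>u. g (u mod c) = g u" and "c > 0"
  shows "(N div c) * card {u. u < c \<and> g u} \<le> card {u. u < N \<and> g u}"
proof -
  let ?R = "{u. u < c \<and> g u}" and ?h = "\<lambda>(j, u). c * j + u"
  have "card ({..<N div c} \<times> ?R) \<le> card {u. u < N \<and> g u}"
  proof (rule card_inj_on_le)
    have "i = j \<and> u = v" if uv: "u < c" "v < c" and eq: "c * i + u = c * j + v" for i u j v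
    proof -
      have "i = (c * i + u) div c" "j = (c * j + v) div c" using uv by simp_all
      then have "i = j" using eq by simp
      then show ?thesis using eq by simp
    qed
    then show "inj_on ?h ({..<N div c} \<times> ?R)" by (auto intro!: inj_onI)
    have "c * j + u < N \<and> g (c * j + u)" if j: "j < N div c" and u: "u < c" "g u" for j u
    proof -
      have "c * j + u < c * Suc j" using u by simp
      also have "\<dots> \<le> c * (N div c)" using j by (intro mult_le_mono2) simp
      also have "\<dots> \<le> N" by simp
      finally have "c * j + u < N" .
      moreover have "g (c * j + u)" using per[of "c * j + u"] u by simp
      ultimately show ?thesis by simp
    qed
    then show "?h ` ({..<N div c} \<times> ?R) \<subseteq> {u. u < N \<and> g u}" by auto
  qed simp
  then show ?thesis by (simp add: card_cartesian_product)
qed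

text \<open>Multiplication by \<open>a\<close> is invertible modulo \<open>n\<close>, so the
  congruence selects exactly one residue class.\<close>

lemma cong_linear_mod_iff:
  fixes a m :: nat
  assumes "coprime a n" "n > 0"
  obtains \<beta> where "\<beta> < n" "\<And>u. [a * u = m] (mod n) \<longleftrightarrow> u mod n = \<beta>"
proof -
  obtain x where x: "[a * x = 1] (mod n)" using cong_solve_coprime_nat[OF assms(1)] by auto
  have ax: "[a * (x * m) = m] (mod n)"
    using cong_scalar_right[OF x, of m] by (simp add: mult.assoc)
  have "[a * u = m] (mod n) \<longleftrightarrow> u mod n = x * m mod n" for u
  proof -
    have "[a * u = m] (mod n) \<longleftrightarrow> [a * u = a * (x * m)] (mod n)"
      using ax cong_sym cong_trans by blast
    also have "\<dots> \<longleftrightarrow> [u = x * m] (mod n)" using assms by (simp add: cong_mult_lcancel_nat)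
    finally show ?thesis by (simp add: cong_def)
  qed
  then show ?thesis using that[of "x * m mod n"] assms by simp
qed

text \<open>
  The residue condition under which \<open>u < m / (a + b)\<close> is matched with a larger number: either
  \<open>u\<close> can play the role of \<open>x\<close> in \<open>a * x + b * y = m\<close>, or it plays the role of \<open>y\<close> with a partner
  that cannot itself play the role of \<open>y\<close>.
\<close>

definition matched :: "nat \<Rightarrow> nat \<Rightarrow> nat \<Rightarrow> nat \<Rightarrow> bool" where
  "matched a b m u \<longleftrightarrow> [a * u = m] (mod b) \<or>
     [b * u = m] (mod a) \<and> \<not> [b * (b * u) + a * m = b * m] (mod a * a)"

section \<open>Counting matched numbers\<close>

text \<open>By the Chinese remainder theorem \<open>u\<close> is given by its residues modulo
  \<open>b\<close> and \<open>a * a\<close>. The first clause of \<open>matched\<close> fixes one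
  class modulo \<open>b\<close> and allows all \<open>a * a\<close> residues. In each of the other
  \<open>b - 1\<close> classes the second clause allows the \<open>a\<close> residues modulo
  \<open>a * a\<close> above one class modulo \<open>a\<close>, except at most one.\<close>

lemma card_matched_period:
  assumes ab: "coprime a b" "a > 0" "b > 0"
  shows "a * a + (a - 1) * (b - 1) \<le> card {u. u < b * (a * a) \<and> matched a b m u}"
proof -
  obtain \<beta> where \<beta>: "\<beta> < b" "\<And>u. [a * u = m] (mod b) \<longleftrightarrow> u mod b = \<beta>"
    using cong_linear_mod_iff[OF ab(1,3)] by metis
  obtain \<delta> where \<delta>: "\<delta> < a" "\<And>u. [b * u = m] (mod a) \<longleftrightarrow> u mod a = \<delta>"
    using cong_linear_mod_iff[of b a] ab by (metis coprime_commute)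
  \<comment> \<open>A natural number congruent to \<open>b * m - a * m\<close> modulo
    \<open>a * a\<close>; adding a multiple of \<open>a * m\<close> avoids the subtraction.\<close>
  define m' where "m' = b * m + (a * a - 1) * (a * m)"
  have m': "[m' + a * m = b * m] (mod a * a)"
  proof -
    have "m' + a * m = b * m + a * a * (a * m)"
      using ab by (cases "a * a") (simp_all add: m'_def algebra_simps)
    then show ?thesis by (simp add: cong_def)
  qed
  have cop: "coprime (b * b) (a * a)" using ab by (simp add: coprime_commute)
  obtain \<gamma> where \<gamma>: "\<And>u. [b * b * u = m'] (mod a * a) \<longleftrightarrow> u mod (a * a) = \<gamma>"
    using cong_linear_mod_iff[OF cop] ab by (metis mult_pos_pos)
  have \<gamma>': "[b * (b * u) + a * m = b * m] (mod a * a) \<longleftrightarrow> u mod (a * a) = \<gamma>" for u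
  proof -
    have "[b * (b * u) + a * m = b * m] (mod a * a) \<longleftrightarrow>
        [b * (b * u) + a * m = m' + a * m] (mod a * a)"
      using m' cong_sym cong_trans by blast
    then show ?thesis using \<gamma> by (simp add: cong_add_rcancel_nat mult.assoc)
  qed
  define Q where "Q = {v. v < a * a \<and> v mod a = \<delta>} - {\<gamma>}"
  define R where "R = {\<beta>} \<times> {..<a * a} \<union> ({..<b} - {\<beta>}) \<times> Q"
  have "card Q \<ge> card {v. v < a * a \<and> v mod a = \<delta>} - 1"
    unfolding Q_def by (simp add: card_Diff_singleton_if)
  then have Q: "card Q \<ge> a - 1" using card_mod_eq[OF \<delta>(1)] by simp
  have finQ: "finite Q" unfolding Q_def by simp
  have "card R = card ({\<beta>} \<times> {..<a * a}) + card (({..<b} - {\<beta>}) \<times> Q)"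
    unfolding R_def using finQ by (intro card_Un_disjoint) auto
  also have "\<dots> = a * a + (b - 1) * card Q" using \<beta> by (simp add: card_cartesian_product)
  also have "\<dots> \<ge> a * a + (b - 1) * (a - 1)" using Q by simp
  finally have "a * a + (a - 1) * (b - 1) \<le> card R" by (simp add: mult.commute)
  also have "\<dots> \<le> card {u. u < b * (a * a) \<and> (u mod b, u mod (a * a)) \<in> R}"
    using ab \<beta> by (intro card_pairs_le_card_residues)
      (auto simp: R_def Q_def coprime_commute)
  also have "\<dots> \<le> card {u. u < b * (a * a) \<and> matched a b m u}"
  proof (rule card_mono)
    show "{u. u < b * (a * a) \<and> (u mod b, u mod (a * a)) \<in> R}
        \<subseteq> {u. u < b * (a * a) \<and> matched a b m u}"
      unfolding matched_def \<gamma>' \<beta> \<delta> R_def Q_def by (auto simp: mod_mod_cancel)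
  qed simp
  finally show ?thesis .
qed

text \<open>The condition depends on \<open>u\<close> only modulo \<open>b\<close>, \<open>a\<close>
  and \<open>a * a\<close>, all of which divide \<open>b * (a * a)\<close>.\<close>

lemma matched_mod: "matched a b m (u mod (b * (a * a))) = matched a b m u"
proof -
  let ?u = "u mod (b * (a * a))"
  have "?u mod b = u mod b" "?u mod a = u mod a" "?u mod (a * a) = u mod (a * a)"
    by (rule mod_mod_cancel, force)+
  then have *: "[?u = u] (mod b)" "[?u = u] (mod a)" "[?u = u] (mod a * a)"
    unfolding cong_def .
  have "[a * ?u = a * u] (mod b)" "[b * ?u = b * u] (mod a)"
    "[b * (b * ?u) + a * m = b * (b * u) + a * m] (mod a * a)"
    by (rule cong_scalar_left[OF *(1)], rule cong_scalar_left[OF *(2)],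
      rule cong_add[OF cong_scalar_left[OF cong_scalar_left[OF *(3)]] cong_refl])
  then show ?thesis unfolding matched_def cong_def by metis
qed

text \<open>Complete periods below \<open>m / (a + b)\<close> are counted: the incomplete last one
  costs at most \<open>\<kappa>\<close>, and the excluded number 0 costs 1.\<close>

lemma card_matched_ge:
  assumes ab: "coprime a b" "a > 0" "b > 0"
  defines "\<kappa> \<equiv> a * a + (a - 1) * (b - 1)"
  shows "real \<kappa> * real m / (real (a + b) * real (b * (a * a))) - real \<kappa> - 1
    \<le> real (card {u \<in> {1..m}. (a + b) * u < m \<and> matched a b m u})"
proof -
  let ?c = "b * (a * a)" and ?N = "m div (a + b)"
  let ?D = "{u \<in> {1..m}. (a + b) * u < m \<and> matched a b m u}"
  have c: "?c > 0" using ab by simp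
  have "real m / (real (a + b) * real ?c) - 1 \<le> real (m div ((a + b) * ?c))"
    using real_div_bounds(2)[of m "(a + b) * ?c"] by simp
  then have "real \<kappa> * (real m / (real (a + b) * real ?c) - 1) \<le> real \<kappa> * real (?N div ?c)"
    by (intro mult_left_mono) (simp_all add: div_mult2_eq)
  also have "\<dots> = real (?N div ?c * \<kappa>)" by simp
  also have "?N div ?c * \<kappa> \<le> ?N div ?c * card {u. u < ?c \<and> matched a b m u}"
    using card_matched_period[OF ab, of m] unfolding \<kappa>_def by (intro mult_le_mono2)
  also have "\<dots> \<le> card {u. u < ?N \<and> matched a b m u}"
    using matched_mod c by (rule card_periodic_ge)
  also have "\<dots> \<le> card (insert 0 ?D)"
  proof (rule card_mono)
    have "(a + b) * u < m" if "u < ?N" for u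
    proof -
      have "(a + b) * u < (a + b) * ?N" using that ab by simp
      also have "\<dots> \<le> m" by simp
      finally show ?thesis .
    qed
    moreover have "u < m" if "u < ?N" for u
      using that div_le_dividend[of m "a + b"] by linarith
    ultimately show "{u. u < ?N \<and> matched a b m u} \<subseteq> insert 0 ?D"
      by (auto simp: Suc_le_eq less_imp_le)
  qed simp
  also have "\<dots> \<le> card ?D + 1" by (simp add: card_insert_if)
  finally show ?thesis by (simp add: algebra_simps)
qed

text \<open>
  Every matched \<open>u < m / (a + b)\<close> is joined by a solution of \<open>a * x + b * y = m\<close> to its own partner
  above \<open>m / (a + b)\<close>, so \<open>W\<close> misses an element for each of them, up to the solutions inside \<open>W\<close>.
\<close>

lemma card_le_solution_pairs:
  fixes a b m :: nat
  assumes ab: "coprime a b" "b \<le> a" "b > 0" and W: "W \<subseteq> {1..m div b}"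
  defines "\<kappa> \<equiv> a * a + (a - 1) * (b - 1)"
  shows "real (card W) \<le> real m / real b * (1 - real \<kappa> / (real (a + b) * real (a * a))) + real \<kappa> + 1
    + real (card {(x, y) \<in> W \<times> W. a * x + b * y = m \<or> b * x + a * y = m})"
proof -
  let ?X = "{(x, y) \<in> W \<times> W. a * x + b * y = m \<or> b * x + a * y = m}"
  define D where "D = {u \<in> {1..m}. (a + b) * u < m \<and> matched a b m u}"
  \<comment> \<open>The partner of \<open>u\<close>: the other entry of a solution with
    \<open>u\<close> as \<open>x\<close> if the first clause of \<open>matched\<close> holds, and
    with \<open>u\<close> as \<open>y\<close> otherwise.\<close>
  define f where "f u = (if [a * u = m] (mod b) then (m - a * u) div b else (m - b * u) div a)" for u
  have a: "a > 0" using ab by simp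
  have finW: "finite W" using W finite_subset by blast
  have finX: "finite ?X" by (rule finite_subset[of _ "W \<times> W"]) (use finW in auto)
  have f1: "a * u + b * f u = m" if "u \<in> D" "[a * u = m] (mod b)" for u
  proof -
    have "a * u \<le> m" using that by (auto simp: D_def algebra_simps)
    moreover from this have "b dvd m - a * u"
      using that by (simp add: cong_sym_eq flip: cong_altdef_nat)
    ultimately show ?thesis using that by (simp add: f_def)
  qed
  have f2: "b * u + a * f u = m" "\<not> [b * (b * u) + a * m = b * m] (mod a * a)"
    if "u \<in> D" "\<not> [a * u = m] (mod b)" for u
  proof -
    have "b * u \<le> m" using that by (auto simp: D_def algebra_simps)
    moreover have "[b * u = m] (mod a)" using that by (auto simp: D_def matched_def)
    ultimately have "b * u \<le> m" "a dvd m - b * u"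
      by (simp_all add: cong_sym_eq flip: cong_altdef_nat)
    then show "b * u + a * f u = m" using that by (simp add: f_def)
    show "\<not> [b * (b * u) + a * m = b * m] (mod a * a)"
      using that by (auto simp: D_def matched_def)
  qed
  have fX: "a * u + b * f u = m \<or> b * u + a * f u = m" if "u \<in> D" for u
    using f1 f2 that by blast
  \<comment> \<open>Both entries equal to \<open>m / (a + b)\<close> would solve the equation, so if
    one entry is smaller, the other is larger.\<close>
  have big: "m < (a + b) * f u" if "u \<in> D" for u
  proof -
    have u: "(a + b) * u < m" using that by (simp add: D_def)
    show ?thesis
    proof (rule ccontr)
      assume "\<not> ?thesis"
      then have "(a + b) * f u \<le> m" by simp
      then have "a * ((a + b) * u) + b * ((a + b) * f u) < a * m + b * m"
          "b * ((a + b) * u) + a * ((a + b) * f u) < b * m + a * m"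
        using u a ab by (simp_all add: add_less_le_mono)
      moreover have "a * ((a + b) * u) + b * ((a + b) * f u) = (a + b) * (a * u + b * f u)"
          "b * ((a + b) * u) + a * ((a + b) * f u) = (a + b) * (b * u + a * f u)"
        by (simp_all add: algebra_simps)
      ultimately show False using fX[OF that] by (auto simp: algebra_simps)
    qed
  qed
  have small: "f u \<in> {1..m div b}" "u \<in> {1..m div b}" if "u \<in> D" for u
  proof -
    have "b * f u \<le> a * f u" using ab(2) by (rule mult_le_mono1)
    then have "b * f u \<le> m" using fX[OF that] by linarith
    moreover have "f u > 0" using big[OF that] by (cases "f u") auto
    ultimately show "f u \<in> {1..m div b}"
      using ab by (simp add: less_eq_div_iff_mult_less_eq mult.commute Suc_le_eq)
    have "b * u \<le> m" "u > 0" using that by (auto simp: D_def algebra_simps)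
    then show "u \<in> {1..m div b}"
      using ab by (simp add: less_eq_div_iff_mult_less_eq mult.commute Suc_le_eq)
  qed
  \<comment> \<open>With a common partner \<open>w\<close>, the equations
    \<open>a * u + b * w = m\<close> and \<open>b * v + a * w = m\<close> give
    \<open>b * (b * v) + a * m = a * a * u + b * m\<close>, which the second clause of
    \<open>matched\<close> excludes modulo \<open>a * a\<close>.\<close>
  have clash: False
    if "u \<in> D" "v \<in> D" "[a * u = m] (mod b)" "\<not> [a * v = m] (mod b)" "f u = f v" for u v
  proof -
    have "a * u + b * f v = m" "b * v + a * f v = m" using that f1[of u] f2[of v] by auto
    moreover have "b * (b * v) + a * (a * u + b * w) = a * a * u + b * (b * v + a * w)" for w
      by (simp add: algebra_simps)
    ultimately have "b * (b * v) + a * m = a * a * u + b * m" by metis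
    then show False using f2(2)[OF that(2,4)] by (simp add: cong_def)
  qed
  have inj: "inj_on f D"
  proof (rule inj_onI)
    fix u v assume uv: "u \<in> D" "v \<in> D" "f u = f v"
    show "u = v"
    proof (cases "[a * u = m] (mod b) \<longleftrightarrow> [a * v = m] (mod b)")
      case False
      then show ?thesis using clash[of u v] clash[of v u] uv by auto
    next
      case True
      show ?thesis
      proof (cases "[a * u = m] (mod b)")
        case 1: True
        then have "a * u + b * f v = a * v + b * f v" using f1[of u] f1[of v] uv True by simp
        then show ?thesis using a by simp
      next
        case 2: False
        then have "b * u + a * f v = b * v + a * f v" using f2(1)[of u] f2(1)[of v] uv True by simp
        then show ?thesis using ab by simp
      qed
    qed
  qed
  have disj: "f u \<noteq> v" if "u \<in> D" "v \<in> D" for u v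
    using big[OF that(1)] that(2) by (auto simp: D_def)
  \<comment> \<open>Matched pairs lying inside \<open>W\<close> are charged to the solutions in
    \<open>W\<close>, all others to elements missing from \<open>W\<close>.\<close>
  define D' where "D' = {u \<in> D. u \<in> W \<and> f u \<in> W}"
  have finD: "finite D" by (simp add: D_def)
  have "card D' \<le> card ?X"
  proof (rule card_inj_on_le)
    show "inj_on (\<lambda>u. (u, f u)) D'" by (auto intro: inj_onI)
    show "(\<lambda>u. (u, f u)) ` D' \<subseteq> ?X" using fX by (auto simp: D'_def)
  qed (rule finX)
  moreover have "card (D - D') \<le> card ({1..m div b} - W)"
  proof (rule card_inj_on_le)
    \<comment> \<open>This selects an element of the pair outside \<open>W\<close>. It is injective
      because \<open>f\<close> is, and because partners lie above \<open>m / (a + b)\<close> while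
      \<open>D\<close> lies below.\<close>
    let ?g = "\<lambda>u. if u \<in> W then f u else u"
    show "inj_on ?g (D - D')"
    proof (rule inj_onI)
      fix u v assume uv: "u \<in> D - D'" "v \<in> D - D'" "?g u = ?g v"
      then have D: "u \<in> D" "v \<in> D" by auto
      show "u = v"
        using uv(3) disj[OF D] disj[OF D(2,1)] inj_onD[OF inj _ D] by (auto split: if_splits)
    qed
    show "?g ` (D - D') \<subseteq> {1..m div b} - W"
      using small by (auto simp: D'_def)
  qed simp
  moreover have "card D = card D' + card (D - D')"
    using finD by (metis (no_types, lifting) D'_def card_Diff_subset card_mono
        finite_subset le_add_diff_inverse mem_Collect_eq subsetI)
  moreover have "card ({1..m div b} - W) = m div b - card W" "card W \<le> m div b"
    using W finW card_mono[of "{1..m div b}" W] by (simp_all add: card_Diff_subset)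
  ultimately have "card W + card D \<le> m div b + card ?X" by linarith
  then have "real (card W) + real (card D) \<le> real (m div b) + real (card ?X)" by linarith
  moreover have "real (m div b) \<le> real m / real b" by (rule real_div_bounds(1))
  moreover have "real \<kappa> * real m / (real (a + b) * real (b * (a * a))) - real \<kappa> - 1 \<le> real (card D)"
    unfolding D_def \<kappa>_def using card_matched_ge[OF ab(1) a ab(3)] .
  moreover have "real m / real b * (1 - real \<kappa> / (real (a + b) * real (a * a)))
      = real m / real b - real \<kappa> * real m / (real (a + b) * real (b * (a * a)))"
    by (simp add: right_diff_distrib mult_ac del: distrib_left distrib_right)
  ultimately show ?thesis by linarith
qed

section \<open>Averaging over the values of z\<close>

text \<open>Summed over \<open>s\<close>, each ordered pair is counted at most twice, and the degree
  bound leaves at most \<open>d * card W\<close> ordered pairs. Some \<open>s\<close> is not above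
  the average.\<close>

lemma exists_few_pairs:
  fixes P q r :: nat
  assumes "finite W" "finite S" "S \<noteq> {}" "r > 0"
    and deg: "\<And>v. v \<in> W \<Longrightarrow>
      card (nbrs (\<lambda>x y. \<exists>s\<in>S. P * x + q * y = r * s \<or> q * x + P * y = r * s) W v) < d"
  shows "\<exists>s\<in>S. card S * card {(x, y) \<in> W \<times> W. P * x + q * y = r * s \<or> q * x + P * y = r * s}
    \<le> 2 * d * card W"
proof (rule ccontr)
  let ?R = "\<lambda>s x y. P * x + q * y = r * s \<or> q * x + P * y = r * s"
  let ?E = "\<lambda>x y. \<exists>s\<in>S. ?R s x y"
  let ?e = "\<lambda>s. card {(x, y) \<in> W \<times> W. ?R s x y}"
  assume "\<not> ?thesis"
  then have "2 * d * card W < card S * ?e s" if "s \<in> S" for s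
    using that not_le by blast
  then have "(\<Sum>s\<in>S. 2 * d * card W) < (\<Sum>s\<in>S. card S * ?e s)"
    using assms by (intro sum_strict_mono) auto
  then have lt: "2 * d * card W < (\<Sum>s\<in>S. ?e s)"
    by (simp flip: sum_distrib_left)
  have e: "?e s = (\<Sum>z\<in>W \<times> W. of_bool (case z of (x, y) \<Rightarrow> ?R s x y))" for s
    using assms(1) by (subst sum_of_bool_eq) (auto intro!: arg_cong[where f = card])
  have two: "(\<Sum>s\<in>S. of_bool (?R s x y)) \<le> 2 * (of_bool (?E x y) :: nat)" for x y
  proof (cases "?E x y")
    case True
    have "(\<Sum>s\<in>S. of_bool (?R s x y)) = card {s \<in> S. ?R s x y}"
      using assms(2) by (subst sum_of_bool_eq) (auto intro!: arg_cong[where f = card])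
    \<comment> \<open>Each of the two equations determines \<open>s\<close> from \<open>x\<close>
      and \<open>y\<close>.\<close>
    also have "\<dots> \<le> card {(P * x + q * y) div r, (q * x + P * y) div r}"
      using assms(4) by (intro card_mono) auto
    also have "\<dots> \<le> 2" by (simp add: card_insert_if)
    finally show ?thesis using True by simp
  next
    case False
    then have "(\<Sum>s\<in>S. of_bool (?R s x y)) = (0 :: nat)" by (intro sum.neutral) auto
    then show ?thesis by simp
  qed
  have "(\<Sum>s\<in>S. ?e s) = (\<Sum>z\<in>W \<times> W. \<Sum>s\<in>S. of_bool (case z of (x, y) \<Rightarrow> ?R s x y))"
    unfolding e by (rule sum.swap)
  also have "\<dots> \<le> (\<Sum>z\<in>W \<times> W. 2 * of_bool (case z of (x, y) \<Rightarrow> ?E x y))"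
    using two by (intro sum_mono) (auto simp: split_beta)
  also have "\<dots> = 2 * (\<Sum>x\<in>W. \<Sum>y\<in>W. of_bool (?E x y))"
    by (simp add: sum.cartesian_product sum_distrib_left split_beta)
  also have "\<dots> = 2 * (\<Sum>x\<in>W. card (nbrs ?E W x))"
    using assms(1) unfolding nbrs_def
    by (subst sum_of_bool_eq) (auto intro!: sum.cong arg_cong[where f = card])
  also have "\<dots> \<le> 2 * (\<Sum>x\<in>W. d)"
    using deg by (intro mult_le_mono2 sum_mono less_imp_le) auto
  finally show False using lt by (simp add: mult.commute mult.left_commute)
qed

subsection \<open>Maximal solution-free sets\<close>

text \<open>The gcd condition enters as coprimality of \<open>t\<close> and \<open>r\<close>, the
  ordering of the coefficients as minimality of the last one, \<open>q\<close>.\<close>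

locale linear_equation =
  fixes k r P q t :: nat and p :: "nat \<Rightarrow> nat"
  assumes k: "k \<ge> 2" and r: "r \<ge> 1" and coprime: "coprime t r"
    and dvd_p: "\<And>i. i \<in> {1..k} \<Longrightarrow> t dvd p i"
    and p_ge: "\<And>i. i \<in> {1..k} \<Longrightarrow> q \<le> p i"
    and q: "q = p k" "r \<le> q"
    and P: "P = (\<Sum>i=1..k-1. p i)" and t: "t = gcd P q"
begin

definition density :: real where
  "density = 1 - real t / (real P + real q) *
    (((real P)^2 + (real P - real t) * (real q - real t)) / (real P)^2)"

text \<open>The additive error \<open>\<kappa> + 1\<close> of the matching bound for the
  coefficients \<open>P div t\<close> and \<open>q div t\<close>; it does not depend on
  \<open>n\<close>.\<close>

definition excess :: real where
  "excess = real (P div t * (P div t) + (P div t - 1) * (q div t - 1)) + 1"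

lemma excess_nonneg: "excess \<ge> 0"
  by (simp add: excess_def)

lemma q_pos: "q > 0" and q_le_P: "q \<le> P" and t_pos: "t > 0"
proof -
  show "q > 0" using r q by simp
  have "q \<le> p 1" using p_ge k by simp
  also have "\<dots> \<le> P" unfolding P using k by (intro member_le_sum) auto
  finally show "q \<le> P" .
  show "t > 0" using t \<open>q > 0\<close> by simp
qed

lemma scaled:
  obtains a b where "P = t * a" "q = t * b" "coprime a b" "b \<le> a" "b > 0"
proof -
  have dvd: "t dvd P" "t dvd q" by (simp_all add: t)
  then have "P = t * (P div t)" "q = t * (q div t)" by simp_all
  moreover have "coprime (P div t) (q div t)"
    unfolding t using q_pos by (intro div_gcd_coprime) simp
  moreover have "q div t \<le> P div t" using q_le_P by (rule div_le_mono)
  moreover have "q div t > 0"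
    using dvd(2) q_pos t_pos by (simp add: div_greater_zero_iff dvd_imp_le)
  ultimately show ?thesis using that by blast
qed

text \<open>The formula is homogeneous of degree 0 in \<open>P\<close>, \<open>q\<close> and
  \<open>t\<close>, so \<open>t\<close> cancels; this is the factor in the matching bound for
  coprime coefficients.\<close>

lemma density_scaled:
  assumes "P = t * a" "q = t * b" "b \<le> a" "b > 0"
  shows "density = 1 - real (a * a + (a - 1) * (b - 1)) / (real (a + b) * real (a * a))"
proof -
  have a1: "real (a - 1) = real a - 1" and b1: "real (b - 1) = real b - 1" using assms by auto
  have "real t / (real P + real q) = 1 / real (a + b)"
  proof -
    have "real t / (real P + real q) = real t * 1 / (real t * real (a + b))"
      unfolding assms(1,2) by (simp add: algebra_simps)
    then show ?thesis using t_pos by (simp only: mult_divide_mult_cancel_left_if) simp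
  qed
  moreover have "(real P)^2 + (real P - real t) * (real q - real t)
      = (real t)^2 * real (a * a + (a - 1) * (b - 1))"
    unfolding assms(1,2) of_nat_add of_nat_mult a1 b1 by (simp add: power2_eq_square algebra_simps)
  moreover have "(real P)^2 = (real t)^2 * real (a * a)"
    unfolding assms(1) by (simp add: power2_eq_square)
  ultimately show ?thesis
    using t_pos unfolding density_def by simp
qed

text \<open>After scaling, the claim follows from \<open>2 * (a - 1) \<le> a * a\<close> and
  \<open>b - 1 \<le> a + b - 2\<close>. It lets \<open>density\<close> absorb the exponent
  \<open>r * n / (2 * q)\<close>.\<close>

lemma density_ge: "density \<ge> 1 / 2"
proof -
  obtain a b where ab: "P = t * a" "q = t * b" "b \<le> a" "b > 0"
    using scaled by blast
  have "2 * (a - 1) \<le> a * a" by (cases a) (auto simp: algebra_simps)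
  then have "2 * (a - 1) * (b - 1) \<le> a * a * (b - 1)" by (rule mult_le_mono1)
  also have "\<dots> \<le> a * a * (a + b - 2)" using ab by (intro mult_le_mono2) auto
  finally have "2 * (a * a + (a - 1) * (b - 1)) \<le> a * a * (2 + (a + b - 2))"
    unfolding distrib_left mult.assoc by linarith
  also have "2 + (a + b - 2) = a + b" using ab by simp
  finally have "2 * real (a * a + (a - 1) * (b - 1)) \<le> real (a * a) * real (a + b)"
    by (metis of_nat_le_iff of_nat_mult of_nat_numeral)
  then have "2 * real (a * a + (a - 1) * (b - 1)) \<le> real (a + b) * real (a * a)"
    by (simp only: mult.commute)
  moreover have "x / y \<le> 1 / 2" if "2 * x \<le> y" "y > 0" for x y :: real
    using that by (simp add: field_simps)
  moreover have "real (a + b) * real (a * a) > 0" using ab by simp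
  ultimately have "real (a * a + (a - 1) * (b - 1)) / (real (a + b) * real (a * a)) \<le> 1 / 2"
    by blast
  then show ?thesis unfolding density_scaled[OF ab] by linarith
qed

section \<open>Sets of low degree\<close>

text \<open>Averaging yields an \<open>s\<close> with few solutions inside \<open>W\<close>.
  Dividing its equation by \<open>t\<close> makes the coefficients coprime, and the matching bound
  applies.\<close>

lemma card_low_degree_le:
  assumes S: "finite S" "card S = K" "K > 0" "\<And>s. s \<in> S \<Longrightarrow> t dvd s \<and> b \<le> s \<and> s \<le> n"
    and W: "W \<subseteq> {1..r * b div q}"
    and deg: "\<And>v. v \<in> W \<Longrightarrow>
      card (nbrs (\<lambda>x y. \<exists>s\<in>S. P * x + q * y = r * s \<or> q * x + P * y = r * s) W v) < d"
  shows "real (card W) \<le> density * real r * real n / real q + excess + 2 * real d * real n / real K"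
proof -
  have finW: "finite W" using W finite_subset by blast
  have "S \<noteq> {}" "r > 0" using S(2,3) r by auto
  from exists_few_pairs[OF finW S(1) this deg, unfolded S(2)] obtain s where s: "s \<in> S"
    "K * card {(x, y) \<in> W \<times> W. P * x + q * y = r * s \<or> q * x + P * y = r * s} \<le> 2 * d * card W"
    by (rule bexE)
  obtain a c where ac: "P = t * a" "q = t * c" "coprime a c" "c \<le> a" "c > 0"
    by (rule scaled)
  obtain s' where s': "s = t * s'" using S(4)[OF s(1)] by (auto elim: dvdE)
  have sn: "b \<le> s" "s \<le> n" using S(4)[OF s(1)] by auto
  \<comment> \<open>As \<open>b\<close> is at most every element of \<open>S\<close>, the set
    \<open>W\<close> lies in the range of the matching bound for whichever \<open>s\<close> was
    selected.\<close>
  have "r * b div q \<le> r * s div q" using sn by (intro div_le_mono mult_le_mono2)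
  also have "\<dots> = r * s' div c"
    using t_pos unfolding s' ac(2) by (simp add: mult.left_commute)
  finally have W': "W \<subseteq> {1..r * s' div c}" using W by auto
  let ?\<kappa> = "a * a + (a - 1) * (c - 1)"
  let ?X = "{(x, y) \<in> W \<times> W. a * x + c * y = r * s' \<or> c * x + a * y = r * s'}"
  have X: "{(x, y) \<in> W \<times> W. P * x + q * y = r * s \<or> q * x + P * y = r * s} = ?X"
  proof -
    have "P * x + q * y = r * s \<longleftrightarrow> a * x + c * y = r * s'"
      "q * x + P * y = r * s \<longleftrightarrow> c * x + a * y = r * s'" for x y
    proof -
      have "P * x + q * y = t * (a * x + c * y)" "q * x + P * y = t * (c * x + a * y)"
        "r * s = t * (r * s')" by (simp_all add: ac s' algebra_simps del: mult_cancel1 mult_cancel2)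
      then show "P * x + q * y = r * s \<longleftrightarrow> a * x + c * y = r * s'"
        "q * x + P * y = r * s \<longleftrightarrow> c * x + a * y = r * s'"
        using t_pos by (simp_all only: mult_cancel1) simp_all
    qed
    then show ?thesis by simp
  qed
  \<comment> \<open>Since \<open>r \<le> q\<close> and \<open>b \<le> n\<close>, \<open>W\<close>
    has at most \<open>n\<close> elements, which bounds the number of solutions inside
    \<open>W\<close> in terms of \<open>n\<close>.\<close>
  have "card W \<le> r * b div q" using card_mono[OF _ W] by simp
  also have "\<dots> \<le> q * n div q" using q sn by (intro div_le_mono mult_le_mono) auto
  also have "\<dots> = n" using q_pos by simp
  finally have "2 * d * card W \<le> 2 * d * n" by simp
  then have "K * card ?X \<le> 2 * d * n" using s(2) unfolding X by linarith
  then have "real (K * card ?X) \<le> real (2 * d * n)" by (simp only: of_nat_le_iff)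
  then have "real K * real (card ?X) \<le> 2 * real d * real n" by simp
  then have "real (card ?X) \<le> 2 * real d * real n / real K"
    using S(3) by (simp add: field_simps)
  moreover have "real (card W) \<le> real (r * s') / real c * density + (real ?\<kappa> + 1) + real (card ?X)"
    using card_le_solution_pairs[OF ac(3,4,5) W'] unfolding density_scaled[OF ac(1,2,4,5)] by simp
  moreover have "real ?\<kappa> + 1 = excess"
  proof -
    have "P div t = a" "q div t = c" using t_pos by (simp_all add: ac)
    then show ?thesis by (simp add: excess_def)
  qed
  moreover have "real (r * s') / real c * density \<le> density * real r * real n / real q"
  proof -
    have "real (r * s') / real c = real r * real s / real q"
      using t_pos by (simp add: ac s')
    also have "\<dots> \<le> real r * real n / real q"
      using sn by (intro divide_right_mono mult_left_mono) auto
    finally have "real (r * s') / real c * density \<le> real r * real n / real q * density"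
      using density_ge by (intro mult_right_mono) auto
    then show ?thesis by (simp add: mult.commute mult.left_commute)
  qed
  ultimately show ?thesis by linarith
qed

section \<open>Reconstruction of a maximal set from its small elements\<close>

lemma pair_solution:
  assumes "solution_free k p r M" "x \<in> M" "y \<in> M" "s \<in> M"
  shows "P * x + q * y \<noteq> r * s"
proof
  assume eq: "P * x + q * y = r * s"
  let ?f = "\<lambda>i. if i = k then y else x"
  have "{1..k} = insert k {1..k-1}" using k by auto
  then have "(\<Sum>i=1..k. p i * ?f i) = p k * y + (\<Sum>i=1..k-1. p i * ?f i)"
    using k by simp
  also have "(\<Sum>i=1..k-1. p i * ?f i) = (\<Sum>i=1..k-1. p i * x)"
    using k by (intro sum.cong) auto
  also have "p k * y + \<dots> = r * s" using eq by (simp add: P q sum_distrib_right)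
  finally have "is_solution k p r ?f s" by (simp add: is_solution_def)
  moreover have "\<forall>i\<in>{1..k}. ?f i \<in> M" using assms by simp
  ultimately have "\<exists>f s. (\<forall>i\<in>{1..k}. f i \<in> M) \<and> s \<in> M \<and> is_solution k p r f s"
    using assms(4) by (intro exI[of _ ?f] exI[of _ s]) simp
  then show False using assms(1) by (simp add: solution_free_def)
qed

text \<open>
  An element above both bounds can only conflict with elements below them and with elements of \<open>S\<close>:
  as \<open>z\<close> it forces all \<open>x i\<close> below \<open>r * b / q\<close>, and as some \<open>x i\<close> it forces \<open>z\<close> into \<open>S\<close> and all other
  \<open>x j\<close> below \<open>r * n / (2 * q)\<close>.
\<close>

lemma maximal_determined:
  assumes M: "maximal_solution_free n k p r M" and M': "maximal_solution_free n k p r M'"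
    and S: "S \<subseteq> M" "S \<subseteq> M'"
    and b: "\<And>z. z \<in> M - S \<Longrightarrow> t dvd z \<Longrightarrow> z \<le> b" "\<And>z. z \<in> M' - S \<Longrightarrow> t dvd z \<Longrightarrow> z \<le> b"
    and H: "r * b div q \<le> H" "r * n div (2 * q) \<le> H"
    and eq: "M \<inter> {1..H} = M' \<inter> {1..H}"
  shows "M \<subseteq> M'"
proof (rule ccontr)
  assume "\<not> M \<subseteq> M'"
  then obtain x where x: "x \<in> M" "x \<notin> M'" by blast
  have sub: "M \<subseteq> {1..n}" "M' \<subseteq> {1..n}" using M M' by (auto simp: maximal_solution_free_def)
  have free: "solution_free k p r M" "solution_free k p r M'"
    using M M' by (auto simp: maximal_solution_free_def)
  have xH: "x > H" using x eq sub by (metis IntD1 IntI atLeastAtMost_iff not_le subsetD)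
  have "M' \<subset> insert x M' \<and> insert x M' \<subseteq> {1..n}" using x sub by auto
  then have "\<not> solution_free k p r (insert x M')"
    using M' by (simp add: maximal_solution_free_def)
  then obtain y z where y: "\<And>i. i \<in> {1..k} \<Longrightarrow> y i \<in> insert x M'" and z: "z \<in> insert x M'"
    and sol: "(\<Sum>i=1..k. p i * y i) = r * z"
    unfolding solution_free_def is_solution_def by blast
  have M_free: False if "\<And>i. i \<in> {1..k} \<Longrightarrow> y i \<in> M" "z \<in> M"
    using free(1) that sol unfolding solution_free_def is_solution_def by blast
  have below: "w \<in> M" if "w \<in> insert x M'" "w \<le> H" for w
    using that xH eq sub by (metis IntD1 IntI atLeastAtMost_iff insertE not_le subsetD)
  \<comment> \<open>As \<open>t\<close> divides every coefficient and is coprime to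
    \<open>r\<close>, it divides \<open>z\<close>, so the threshold \<open>b\<close> applies to
    \<open>z\<close>.\<close>
  have "t dvd r * z" unfolding sol[symmetric] by (intro dvd_sum dvd_mult2 dvd_p) auto
  then have tz: "t dvd z" using coprime coprime_dvd_mult_right_iff by blast
  have le_z: "q * y i \<le> r * z" if "i \<in> {1..k}" for i
  proof -
    have "q * y i \<le> p i * y i" using p_ge[OF that] by simp
    also have "\<dots> \<le> (\<Sum>i=1..k. p i * y i)" using that by (intro member_le_sum) auto
    finally show ?thesis using sol by simp
  qed
  have le_H: "w \<le> H" if "q * w \<le> r * b" for w
  proof -
    have "w \<le> r * b div q"
      using that q_pos by (simp add: less_eq_div_iff_mult_less_eq mult.commute)
    then show ?thesis using H(1) by linarith
  qed
  show False
  proof (cases "z = x")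
    case True
    then have "z \<le> b" using b(1) x tz S by blast
    then have "q * y i \<le> r * b" if "i \<in> {1..k}" for i
      using le_z[OF that] by (meson le_trans mult_le_mono2)
    then show False using M_free below y le_H x True by blast
  next
    case False
    then have z': "z \<in> M'" using z by simp
    \<comment> \<open>Since \<open>M'\<close> is solution-free and contains \<open>z\<close>, the
      new element \<open>x\<close> must be one of the \<open>y i\<close>.\<close>
    obtain i where i: "i \<in> {1..k}" "y i = x"
      using free(2) y z' sol unfolding solution_free_def is_solution_def by blast
    have "\<not> z \<le> b"
    proof
      assume "z \<le> b"
      then have "q * x \<le> r * b" using le_z[OF i(1)] i(2) by (meson le_trans mult_le_mono2)
      then show False using le_H xH by (simp add: leD)
    qed
    then have "z \<in> S" using b(2) z' tz by blast
    moreover have "y j \<in> M" if j: "j \<in> {1..k}" for j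
    proof (cases "y j \<le> H \<or> j = i")
      case True
      then show ?thesis using below y[OF j] i x by auto
    next
      case False
      \<comment> \<open>Two positions with entries above \<open>r * n / (2 * q)\<close> would push
        the left-hand side beyond \<open>r * n\<close>, hence beyond \<open>r * z\<close>.\<close>
      then have "y j > r * n div (2 * q)" "x > r * n div (2 * q)" using xH H(2) by auto
      then have "r * n < y j * (2 * q)" "r * n < x * (2 * q)"
        using q_pos by (simp_all add: div_less_iff_less_mult)
      then have "r * n < q * x + q * y j" by (simp add: algebra_simps)
      also have "\<dots> \<le> p i * y i + p j * y j"
        using p_ge i j by (intro add_mono mult_le_mono) auto
      also have "\<dots> = (\<Sum>i\<in>{i, j}. p i * y i)" using False by simp
      also have "\<dots> \<le> (\<Sum>i=1..k. p i * y i)" using i j by (intro sum_mono2) auto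
      also have "\<dots> \<le> r * n" using sol z' sub by auto
      finally show ?thesis by simp
    qed
    ultimately show False using M_free S(1) by blast
  qed
qed

section \<open>Union bound over the largest multiples of t\<close>

text \<open>The maximal sets compatible with one guess \<open>(S, b)\<close>. Families for different
  guesses may overlap, which is harmless in a union bound.\<close>

definition maximal_with_top :: "nat \<Rightarrow> nat set \<times> nat \<Rightarrow> nat set set" where
  "maximal_with_top n = (\<lambda>(S, b). {M. maximal_solution_free n k p r M \<and> S \<subseteq> M \<and>
    (\<forall>z\<in>M - S. t dvd z \<longrightarrow> z \<le> b)})"

lemma finite_maximal: "finite {M. maximal_solution_free n k p r M}"
  by (rule finite_subset[of _ "Pow {1..n}"]) (auto simp: maximal_solution_free_def)

text \<open>Intersection with \<open>{1..H}\<close> is injective for \<open>H\<close> the larger of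
  the two bounds. One case counts all subsets, using \<open>density \<ge> 1 / 2\<close>; the other
  counts independent sets by branching.\<close>

lemma card_maximal_with_top_le:
  assumes S: "S \<subseteq> {1..n}" "\<And>s. s \<in> S \<Longrightarrow> t dvd s \<and> b \<le> s" "b = 0 \<or> card S = K" "K > 0"
    and l: "l \<ge> 1" "l ^ d \<ge> l ^ (d - 1) + 1"
  shows "real (card (maximal_with_top n (S, b))) \<le>
    l ^ n * 2 powr (density * real r * real n / real q + excess + 2 * real d * real n / real K)"
    (is "_ \<le> l ^ n * 2 powr ?m")
proof -
  let ?F = "maximal_with_top n (S, b)"
  have finS: "finite S" using S(1) finite_subset by blast
  have inj: "inj_on (\<lambda>M. M \<inter> {1..H}) ?F" if "r * b div q \<le> H" "r * n div (2 * q) \<le> H" for H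
  proof (rule inj_onI)
    fix M M' assume "M \<in> ?F" "M' \<in> ?F" and eq: "M \<inter> {1..H} = M' \<inter> {1..H}"
    then have M: "maximal_solution_free n k p r M" "S \<subseteq> M" "\<And>z. z \<in> M - S \<Longrightarrow> t dvd z \<Longrightarrow> z \<le> b"
      and M': "maximal_solution_free n k p r M'" "S \<subseteq> M'" "\<And>z. z \<in> M' - S \<Longrightarrow> t dvd z \<Longrightarrow> z \<le> b"
      unfolding maximal_with_top_def by blast+
    show "M = M'"
      using maximal_determined[OF M(1) M'(1) M(2) M'(2) M(3) M'(3) that eq]
        maximal_determined[OF M'(1) M(1) M'(2) M(2) M'(3) M(3) that eq[symmetric]] by blast
  qed
  show ?thesis
  proof (cases "r * b div q \<le> r * n div (2 * q)")
    case True
    let ?H = "r * n div (2 * q)"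
    have "card ?F \<le> card (Pow {1..?H})"
      using inj[OF True] by (intro card_inj_on_le[of "\<lambda>M. M \<inter> {1..?H}"]) auto
    also have "\<dots> = 2 ^ ?H" by (simp add: card_Pow)
    finally have "real (card ?F) \<le> 2 powr real ?H"
      by (simp add: powr_realpow)
    also have "\<dots> \<le> 2 powr ?m"
    proof -
      have "real ?H \<le> real (r * n) / real (2 * q)" by (rule real_div_bounds(1))
      also have "\<dots> = 1 / 2 * (real r * real n / real q)" by simp
      also have "\<dots> \<le> density * (real r * real n / real q)"
        using density_ge by (intro mult_right_mono) auto
      also have "\<dots> \<le> ?m" using excess_nonneg by (simp add: mult.assoc)
      finally show ?thesis by simp
    qed
    also have "\<dots> \<le> l ^ n * 2 powr ?m" using l by simp
    finally show ?thesis .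
  next
    case False
    \<comment> \<open>For \<open>b = 0\<close> the first bound would vanish and the previous case
      would apply; so \<open>S\<close> has its full size \<open>K\<close>, as averaging
      requires.\<close>
    then have "b \<noteq> 0" by (cases b) auto
    then have K: "card S = K" using S(3) by simp
    let ?H = "r * b div q"
    let ?E = "\<lambda>x y. \<exists>s\<in>S. P * x + q * y = r * s \<or> q * x + P * y = r * s"
    have "S \<noteq> {}" using K S(4) by auto
    then have bn: "b \<le> n" using S(1,2) by (meson atLeastAtMost_iff ex_in_conv le_trans subsetD)
    have "?H \<le> q * n div q" using q bn by (intro div_le_mono mult_le_mono) auto
    then have Hn: "?H \<le> n" using q_pos by simp
    have "card ?F \<le> card (indep_sets ?E {1..?H})"
    proof (rule card_inj_on_le[of "\<lambda>M. M \<inter> {1..?H}"])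
      show "inj_on (\<lambda>M. M \<inter> {1..?H}) ?F" using inj[of ?H] False by simp
      show "(\<lambda>M. M \<inter> {1..?H}) ` ?F \<subseteq> indep_sets ?E {1..?H}"
      proof clarify
        fix M assume "M \<in> ?F"
        then have "solution_free k p r M" "S \<subseteq> M"
          by (auto simp: maximal_with_top_def maximal_solution_free_def)
        then have "\<not> ?E x y" if "x \<in> M" "y \<in> M" for x y
          using pair_solution[of M x y] pair_solution[of M y x] that by (auto simp: add.commute)
        then show "M \<inter> {1..?H} \<in> indep_sets ?E {1..?H}" by (auto simp: indep_sets_def)
      qed
    qed (simp add: finite_indep_sets)
    then have "real (card ?F) \<le> real (card (indep_sets ?E {1..?H}))" by simp
    also have "\<dots> \<le> l ^ card {1..?H} * 2 powr ?m"
    proof (rule card_indep_sets_le[OF _ l])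
      fix W assume "W \<subseteq> {1..?H}" "\<And>v. v \<in> W \<Longrightarrow> card (nbrs ?E W v) < d"
      then show "real (card W) \<le> ?m"
        using S finS K by (intro card_low_degree_le[of S K b n W d]) auto
    qed simp
    also have "\<dots> \<le> l ^ n * 2 powr ?m"
      using Hn l by (intro mult_right_mono power_increasing) auto
    finally show ?thesis .
  qed
qed

text \<open>Each maximal set lies in the family given by its own largest multiples of
  \<open>t\<close>, and at most \<open>(n + 1) ^ (K + 1)\<close> pairs \<open>(S, b)\<close>
  occur.\<close>

lemma f_max_le:
  assumes K: "K > 0" and l: "l \<ge> 1" "l ^ d \<ge> l ^ (d - 1) + 1"
  shows "real (f_max n k p r) \<le> real (n + 1) ^ (K + 1) * (l ^ n *
    2 powr (density * real r * real n / real q + excess + 2 * real d * real n / real K))"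
    (is "_ \<le> _ * ?B")
proof -
  define I where "I = {(S, b). S \<subseteq> {1..n} \<and> card S \<le> K \<and> b \<le> n \<and>
    (\<forall>s\<in>S. t dvd s \<and> b \<le> s) \<and> (b = 0 \<or> card S = K)}"
  have I_sub: "I \<subseteq> {S. S \<subseteq> {1..n} \<and> card S \<le> K} \<times> {0..n}" by (auto simp: I_def)
  have fin: "finite ({S. S \<subseteq> {1..n} \<and> card S \<le> K} \<times> {0..n})"
    by (rule finite_cartesian_product) (auto intro: finite_subset[of _ "Pow {1..n}"])
  have finI: "finite I" using I_sub fin finite_subset by blast
  have "card I \<le> card {S. S \<subseteq> {1..n} \<and> card S \<le> K} * (n + 1)"
    using card_mono[OF fin I_sub] by (simp add: card_cartesian_product)
  also have "\<dots> \<le> (n + 1) ^ K * (n + 1)"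
    using card_bounded_subsets_le by (rule mult_le_mono1)
  also have "\<dots> = (n + 1) ^ (K + 1)" by simp
  finally have cardI: "card I \<le> (n + 1) ^ (K + 1)" .
  have "{M. maximal_solution_free n k p r M} \<subseteq> (\<Union>i\<in>I. maximal_with_top n i)"
  proof clarify
    fix M assume M: "maximal_solution_free n k p r M"
    then have sub: "M \<subseteq> {1..n}" by (simp add: maximal_solution_free_def)
    let ?T = "{z \<in> M. t dvd z}"
    have "finite ?T" using sub finite_subset by fastforce
    from exists_top_subset[OF this, of K] obtain S b where
      S: "S \<subseteq> ?T" "card S \<le> K" "\<forall>z\<in>?T - S. z \<le> b" "\<forall>s\<in>S. b \<le> s" "b = 0 \<or> card S = K"
      by blast
    have "b \<le> n"
    proof (cases "b = 0")
      case False
      then have "S \<noteq> {}" using S(5) K by auto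
      then obtain s where "s \<in> S" by blast
      then have "b \<le> s" "s \<in> {1..n}" using S sub by auto
      then show ?thesis by simp
    qed simp
    then have "(S, b) \<in> I" using S sub by (auto simp: I_def)
    moreover have "M \<in> maximal_with_top n (S, b)" using M S by (auto simp: maximal_with_top_def)
    ultimately show "M \<in> (\<Union>i\<in>I. maximal_with_top n i)" by blast
  qed
  moreover have "finite (\<Union>i\<in>I. maximal_with_top n i)"
    by (rule finite_subset[OF _ finite_maximal]) (auto simp: maximal_with_top_def)
  ultimately have "f_max n k p r \<le> card (\<Union>i\<in>I. maximal_with_top n i)"
    unfolding f_max_def by (intro card_mono)
  also have "\<dots> \<le> (\<Sum>i\<in>I. card (maximal_with_top n i))"
    using finI by (rule card_UN_le)
  finally have "real (f_max n k p r) \<le> (\<Sum>i\<in>I. real (card (maximal_with_top n i)))"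
    by (metis of_nat_le_iff of_nat_sum)
  also have "\<dots> \<le> (\<Sum>i\<in>I. ?B)"
  proof (rule sum_mono)
    fix i assume "i \<in> I"
    then show "real (card (maximal_with_top n i)) \<le> ?B"
      using K l by (cases i) (auto simp only: I_def mem_Collect_eq case_prod_conv intro!: card_maximal_with_top_le)
  qed
  also have "\<dots> = real (card I) * ?B" by simp
  also have "\<dots> \<le> real (n + 1) ^ (K + 1) * ?B"
  proof (rule mult_right_mono)
    show "real (card I) \<le> real (n + 1) ^ (K + 1)"
      using cardI by (metis of_nat_le_iff of_nat_power)
  qed (use l in simp)
  finally show ?thesis .
qed

section \<open>Asymptotics\<close>

text \<open>First \<open>l\<close> is chosen near 1, then \<open>d\<close> from \<open>l\<close>,
  then \<open>K\<close> from \<open>d\<close> and \<open>\<epsilon>\<close>. The branching cost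
  \<open>l ^ n\<close>, the edge term, and the polynomial factor together with \<open>excess\<close>
  then each contribute at most \<open>\<epsilon> / 3 * n\<close> to the exponent.\<close>

lemma log_f_max_eventually_le:
  assumes "\<epsilon> > 0"
  shows "\<forall>\<^sub>F n in sequentially.
    log 2 (max 1 (real (f_max n k p r))) \<le> density * real r * real n / real q + \<epsilon> * real n"
proof -
  define l :: real where "l = 2 powr (\<epsilon> / 3)"
  have "l > 1" using assms by (simp add: l_def)
  then obtain d where d: "l ^ d \<ge> l ^ (d - 1) + 1" using exists_branching_degree by blast
  obtain K' where "6 * real d / \<epsilon> < real K'" using reals_Archimedean2 by blast
  define K where "K = Suc K'"
  have K: "K > 0" "2 * real d / real K \<le> \<epsilon> / 3"
    using \<open>6 * real d / \<epsilon> < real K'\<close> assms by (auto simp: K_def field_simps)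
  have "((\<lambda>n. (real (K + 1) * log 2 (real (n + 1)) + excess) / real n) \<longlongrightarrow> 0) sequentially"
    by real_asymp
  then have "\<forall>\<^sub>F n in sequentially. (real (K + 1) * log 2 (real (n + 1)) + excess) / real n < \<epsilon> / 3"
    using assms by (intro order_tendstoD) auto
  then show ?thesis
    using eventually_gt_at_top[of 0]
  proof eventually_elim
    case (elim n)
    let ?A = "density * real r * real n / real q" and ?c = "2 * real d * real n / real K"
    let ?B = "real (n + 1) ^ (K + 1) * (l ^ n * 2 powr (?A + excess + ?c))"
    have "?A + excess + ?c \<ge> 0" using density_ge excess_nonneg by simp
    then have "?B \<ge> 1"
      using \<open>l > 1\<close> by (intro mult_ge1_I one_le_power ge_one_powr_ge_zero) auto
    then have "max 1 (real (f_max n k p r)) \<le> ?B"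
      using f_max_le[OF K(1) _ d, of n] \<open>l > 1\<close> by simp
    then have "log 2 (max 1 (real (f_max n k p r))) \<le> log 2 ?B" by simp
    also have "log 2 ?B = real (K + 1) * log 2 (real (n + 1)) + (real n * (\<epsilon> / 3) + (?A + excess + ?c))"
      using \<open>l > 1\<close> by (simp add: log_mult log_nat_power l_def del: power_Suc)
    also have "real (K + 1) * log 2 (real (n + 1)) + excess \<le> \<epsilon> / 3 * real n"
      using elim by (simp add: field_simps)
    then have "real (K + 1) * log 2 (real (n + 1)) + (real n * (\<epsilon> / 3) + (?A + excess + ?c))
        \<le> ?A + (real n * (\<epsilon> / 3) + \<epsilon> / 3 * real n) + ?c" by linarith
    also have "?c \<le> \<epsilon> / 3 * real n"
      using mult_right_mono[OF K(2), of "real n"] by simp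
    finally have "log 2 (max 1 (real (f_max n k p r)))
        \<le> ?A + (real n * (\<epsilon> / 3) + \<epsilon> / 3 * real n) + \<epsilon> / 3 * real n" by simp
    also have "\<dots> = ?A + \<epsilon> * real n" by (simp add: algebra_simps)
    finally show ?case .
  qed
qed

lemma f_max_bound:
  "\<exists>g :: nat \<Rightarrow> real. g \<in> o(\<lambda>n. real n) \<and>
    (\<forall>n. real (f_max n k p r) \<le> 2 powr (density * real r * real n / real q + g n))"
proof (intro exI conjI allI)
  let ?A = "\<lambda>n. density * real r * real n / real q"
  \<comment> \<open>The positive part makes the bound hold for every \<open>n\<close> and reduces
    smallness of \<open>?g\<close> to the eventual upper bound.\<close>
  let ?g = "\<lambda>n. max 0 (log 2 (max 1 (real (f_max n k p r))) - ?A n)"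
  show "?g \<in> o(\<lambda>n. real n)"
  proof (rule landau_o.smallI)
    fix \<epsilon> :: real assume "\<epsilon> > 0"
    from log_f_max_eventually_le[OF this]
    show "\<forall>\<^sub>F n in sequentially. norm (?g n) \<le> \<epsilon> * norm (real n)"
      by eventually_elim (use \<open>\<epsilon> > 0\<close> in auto)
  qed
  fix n
  have "real (f_max n k p r) \<le> max 1 (real (f_max n k p r))" by simp
  also have "\<dots> = 2 powr log 2 (max 1 (real (f_max n k p r)))" by simp
  also have "\<dots> \<le> 2 powr (?A n + ?g n)" by (intro powr_mono) auto
  finally show "real (f_max n k p r) \<le> 2 powr (?A n + ?g n)" .
qed

end

theorem theorem4p1:
  fixes k r P q t :: nat and p :: "nat \<Rightarrow> nat" and C :: real
  assumes "k \<ge> 2"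
    and "r \<ge> 1"
    and "Gcd (insert r (p ` {1..k})) = 1"
    and "\<forall>i\<in>{1..k}. \<forall>j\<in>{1..k}. i \<le> j \<longrightarrow> p i \<ge> p j"
    and "p k \<ge> r"
    and "P = (\<Sum>i=1..k-1. p i)"
    and "q = p k"
    and "t = gcd P q"
    and "t = Gcd (p ` {1..k})"
    and "C = 1 - real t / (real P + real q) *
               (((real P)^2 + (real P - real t) * (real q - real t)) / (real P)^2)"
  shows "\<exists>g :: nat \<Rightarrow> real. g \<in> o(\<lambda>n. real n) \<and>
           (\<forall>n. real (f_max n k p r) \<le> 2 powr (C * real r * real n / real q + g n))"
proof -
  interpret linear_equation k r P q t p
  proof
    \<comment> \<open>The gcd of \<open>r\<close> and all coefficients is \<open>gcd r t\<close>,
      because \<open>t\<close> is the gcd of the coefficients.\<close>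
    have "gcd r t = 1" using assms(3,9) by simp
    then show "coprime t r" by (simp add: coprime_iff_gcd_eq_1 gcd.commute)
    show "t dvd p i" if "i \<in> {1..k}" for i unfolding assms(9) using that by (intro Gcd_dvd) auto
    show "q \<le> p i" if "i \<in> {1..k}" for i
    proof -
      have "k \<in> {1..k}" "i \<le> k" using that by auto
      then show ?thesis unfolding assms(7) using assms(4) that by blast
    qed
    show "r \<le> q" unfolding assms(7) by (rule assms(5))
    show "P = (\<Sum>i=1..k-1. p i)" "q = p k" "t = gcd P q" by (rule assms)+
  qed (rule assms)+
  have "density = C" by (simp only: density_def assms(10))
  then show ?thesis using f_max_bound by simp
qed

end
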